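(* Let $m\ge 2$ and let $C_n\in\mathbb{R}^{m\times m}$ be a (symmetric) sample covariance matrix. Consider the linear system in the unknown $y\in\mathbb{R}^{m(m-1)/2}$ $$A_nBy=0,\qquad y\le 0\ \text{(entrywise)},\qquad \sum_{i=1}^{m-1}y_i\neq 0 .$$ If this system has no solution, then there exists $\bar\delta_n>0$ such that for all $\delta\in[0,\bar\delta_n)$ the problem rSpecT with data $C_n$ and tolerance $\delta$ is infeasible, i.e. there is no $S\in\mathcal{S}$ with $\sum_{j=1}^m S_{1j}=1$ and $\|C_nS-SC_n\|_F\le\delta$.
   Context: $\mathcal{S}:=\{S\in\mathbb{R}^{m\times m}: S=S^\top,\ \operatorname{diag}(S)=0,\ S\ge 0 \text{ entrywise}\}$ is the set of valid adjacency matrices. $\|\cdot\|_F$ is the Frobenius norm and $\|S\|_{1,1}=\sum_{i,j}|S_{ij}|$. The problem rSpecT with data $C_n$ and tolerance $\delta\ge0$ is: minimize $\|S\|_{1,1}$ over $S\in\mathcal{S}$ subject to $\sum_{j=1}^m S_{1j}=1$ and $\|C_nS-SC_n\|_F\le\delta$. The matrix $A_n:=I_m\otimes C_n-C_n\otimes I_m\in\mathbb{R}^{m^2\times m^2}$ (Kronecker products), so that $A_n\operatorname{vec}(S)=\operatorname{vec}(C_nS-SC_n)$. The matrix $B\in\mathbb{R}^{m^2\times m(m-1)/2}$ is the linear operator sending a vector of $m(m-1)/2$ edge weights to the vectorization of the corresponding symmetric zero-diagonal matrix: for $i,j\in\{1,\dots,m\}$, $$(Bx)_{m(i-1)+j}=\begin{cases}x_{\,i-j+\frac{j-1}{2}(2m-j)},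 & i>j,\\ 0,& i=j,\\ x_{\,j-i+\frac{i-1}{2}(2m-i)},& i<j.\end{cases}$$ In particular the first $m-1$ coordinates of $x$ are the weights of the edges incident to node $1$. *)

theory Defs
  imports Complex_Main "Jordan_Normal_Form.Matrix"
begin

(* Matrices and vectors are those of Jordan_Normal_Form, so rows, columns and coordinates are
   numbered from 0: node 1 of the network is index 0, and coordinate k of a weight vector is
   index k - 1. *)

definition valid_adjacency :: "nat \<Rightarrow> real mat set" where
  "valid_adjacency m =
     {S \<in> carrier_mat m m. transpose_mat S = S \<and> (\<forall>i<m. S $$ (i, i) = 0) \<and>
        (\<forall>i<m. \<forall>j<m. 0 \<le> S $$ (i, j))}"

definition frobenius_norm :: "real mat \<Rightarrow> real" where
  "frobenius_norm M = sqrt (\<Sum>i<dim_row M. \<Sum>j<dim_col M. (M $$ (i, j))\<^sup>2)"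

definition entrywise_l1_norm :: "real mat \<Rightarrow> real" where
  "entrywise_l1_norm M = (\<Sum>i<dim_row M. \<Sum>j<dim_col M. \<bar>M $$ (i, j)\<bar>)"

definition rSpecT_feasible_set :: "nat \<Rightarrow> real mat \<Rightarrow> real \<Rightarrow> real mat set" where
  "rSpecT_feasible_set m C \<delta> =
     {S \<in> valid_adjacency m. (\<Sum>j<m. S $$ (0, j)) = 1 \<and> frobenius_norm (C * S - S * C) \<le> \<delta>}"

(* Infeasibility of rSpecT does not involve its objective; the minimizers are recorded to pin
   down the optimization problem. *)
definition rSpecT_solutions :: "nat \<Rightarrow> real mat \<Rightarrow> real \<Rightarrow> real mat set" where
  "rSpecT_solutions m C \<delta> =
     {S \<in> rSpecT_feasible_set m C \<delta>.
        \<forall>T \<in> rSpecT_feasible_set m C \<delta>. entrywise_l1_norm S \<le> entrywise_l1_norm T}"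

definition rSpecT_infeasible :: "nat \<Rightarrow> real mat \<Rightarrow> real \<Rightarrow> bool" where
  "rSpecT_infeasible m C \<delta> \<longleftrightarrow> rSpecT_feasible_set m C \<delta> = {}"

definition kronecker :: "real mat \<Rightarrow> real mat \<Rightarrow> real mat" where
  "kronecker P Q = mat (dim_row P * dim_row Q) (dim_col P * dim_col Q)
     (\<lambda>(i, j). P $$ (i div dim_row Q, j div dim_col Q) * Q $$ (i mod dim_row Q, j mod dim_col Q))"

definition commutator_mat :: "nat \<Rightarrow> real mat \<Rightarrow> real mat" where
  "commutator_mat m C = kronecker (1\<^sub>m m) C - kronecker C (1\<^sub>m m)"

(* The 1-based position of the edge {i, j}, 1 \<le> j < i \<le> m, in the weight vector.  The product
   (j - 1) * (2 * m - j) is even, so div is exact. *)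
definition edge_index :: "nat \<Rightarrow> nat \<Rightarrow> nat \<Rightarrow> nat" where
  "edge_index m i j = i - j + ((j - 1) * (2 * m - j)) div 2"

(* Row m (i - 1) + j (1-based) of the matrix is row m * (i - 1) + (j - 1) here; edge_matrix_mult
   below is the coordinate formula for the operator. *)
definition edge_matrix :: "nat \<Rightarrow> real mat" where
  "edge_matrix m = mat (m * m) (m * (m - 1) div 2)
     (\<lambda>(p, q). let i = p div m + 1; j = p mod m + 1; k = q + 1 in
        if j < i \<and> k = edge_index m i j \<or> i < j \<and> k = edge_index m j i then 1 else 0)"

definition vec_of_mat :: "real mat \<Rightarrow> real vec" where
  "vec_of_mat M = vec (dim_row M * dim_col M) (\<lambda>k. M $$ (k mod dim_row M, k div dim_row M))"

lemma edge_index_bounds: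
  assumes "1 \<le> j" "j < i" "i \<le> m"
  shows "1 \<le> edge_index m i j" "edge_index m i j \<le> m * (m - 1) div 2"
proof -
  show "1 \<le> edge_index m i j" using assms by (simp add: edge_index_def)
  obtain a where a: "j = Suc a" using assms by (cases j) auto
  obtain b where b: "i = Suc (a + Suc b)"
    using assms(2) unfolding a by (auto dest: less_imp_Suc_add)
  obtain c where c: "m = i + c" using assms(3) le_Suc_ex by blast
  have "2 * edge_index m i j \<le> 2 * (i - j) + (j - 1) * (2 * m - j)"
    unfolding edge_index_def by simp
  also have "\<dots> \<le> m * (m - 1)"
    unfolding c b a by (simp add: algebra_simps)
  finally show "edge_index m i j \<le> m * (m - 1) div 2" by simp
qed

lemma edge_matrix_mult:
  assumes x: "x \<in> carrier_vec (m * (m - 1) div 2)"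
    and i: "1 \<le> i" "i \<le> m" and j: "1 \<le> j" "j \<le> m"
  shows "(edge_matrix m *\<^sub>v x) $ (m * (i - 1) + j - 1) =
    (if j < i then x $ (edge_index m i j - 1)
     else if i = j then 0
     else x $ (edge_index m j i - 1))"
proof -
  define p where "p = m * (i - 1) + (j - 1)"
  have p_eq: "m * (i - 1) + j - 1 = p" using j by (simp add: p_def)
  have "(i - 1) * m + (j - 1) < (i - 1) * m + m" using j by simp
  also have "\<dots> = i * m" using i by (cases i) auto
  also have "\<dots> \<le> m * m" using i by simp
  finally have p: "p < m * m" by (simp add: p_def mult.commute)
  have "j - 1 < m" using j by linarith
  then have "p div m = i - 1" "p mod m = j - 1" by (simp_all add: p_def)
  then have d: "p div m + 1 = i" "p mod m + 1 = j" using i j by simp_all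
  let ?N = "m * (m - 1) div 2"
  have "(edge_matrix m *\<^sub>v x) $ p = (\<Sum>q<?N. edge_matrix m $$ (p, q) * x $ q)"
    using p x by (auto simp: edge_matrix_def scalar_prod_def lessThan_atLeast0 intro!: sum.cong)
  also have "\<dots> = (\<Sum>q<?N. (if j < i \<and> q + 1 = edge_index m i j \<or>
      i < j \<and> q + 1 = edge_index m j i then 1 else 0) * x $ q)"
    using p d by (intro sum.cong) (simp_all add: edge_matrix_def Let_def)
  also have "\<dots> = (if j < i then x $ (edge_index m i j - 1) else if i = j then 0
     else x $ (edge_index m j i - 1))"
  proof -
    have one: "(\<Sum>q<?N. (if q + 1 = k then 1 else 0) * x $ q) = x $ (k - 1)"
      if "1 \<le> k" "k \<le> ?N" for k
    proof -
      have "(\<Sum>q<?N. (if q + 1 = k then 1 else 0) * x $ q)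
          = (\<Sum>q<?N. if q = k - 1 then x $ q else 0)"
        using that by (intro sum.cong) auto
      also have "\<dots> = x $ (k - 1)" using that by (simp add: sum.delta)
      finally show ?thesis .
    qed
    consider "j < i" | "i = j" | "i < j" by linarith
    then show ?thesis
    proof cases
      case 1
      then show ?thesis using one[OF edge_index_bounds[of j i m]] i j by simp
    next
      case 3
      then show ?thesis using one[OF edge_index_bounds[of i j m]] i j by simp
    qed simp
  qed
  finally show ?thesis unfolding p_eq .
qed

lemma commutator_mat_mult_vec:
  assumes C: "C \<in> carrier_mat m m" "transpose_mat C = C" and S: "S \<in> carrier_mat m m"
  shows "commutator_mat m C *\<^sub>v vec_of_mat S = vec_of_mat (C * S - S * C)"
proof (intro eq_vecI)
  fix p assume "p < dim_vec (vec_of_mat (C * S - S * C))"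
  then have p: "p < m * m" using C S by (simp add: vec_of_mat_def)
  then have m: "m > 0" by (cases m) auto
  define a b where "a = p mod m" and "b = p div m"
  have ab: "a < m" "b < m" using p m by (auto simp: a_def b_def less_mult_imp_div_less)
  have sym: "C $$ (i, j) = C $$ (j, i)" if "i < m" "j < m" for i j
    using that C by (metis carrier_matD index_transpose_mat(1))
  have split: "(\<Sum>q<m * m. f (q div m) (q mod m)) = (\<Sum>j<m. \<Sum>i<m. f j i)"
    for f :: "nat \<Rightarrow> nat \<Rightarrow> real"
  proof -
    have "(\<Sum>j<m. \<Sum>i<m. f j i) = (\<Sum>(j, i)\<in>{..<m} \<times> {..<m}. f j i)"
      by (simp add: sum.cartesian_product)
    also have "\<dots> = (\<Sum>q<m * m. f (q div m) (q mod m))"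
    proof (rule sum.reindex_bij_witness[of _ "\<lambda>q. (q div m, q mod m)" "\<lambda>(j, i). j * m + i"])
      fix z assume "z \<in> {..<m} \<times> {..<m}"
      then obtain j i where z: "z = (j, i)" "j < m" "i < m" by auto
      have "j * m + i < j * m + m" using z by simp
      also have "\<dots> = Suc j * m" by simp
      also have "\<dots> \<le> m * m" using z by (intro mult_le_mono1) simp
      finally show "(case z of (j, i) \<Rightarrow> j * m + i) \<in> {..<m * m}" using z by simp
    qed (use m in \<open>auto simp: less_mult_imp_div_less\<close>)
    finally show ?thesis by simp
  qed
  have "(commutator_mat m C *\<^sub>v vec_of_mat S) $ p =
      (\<Sum>q<m * m. commutator_mat m C $$ (p, q) * vec_of_mat S $ q)"
    using p C S
    by (auto simp: commutator_mat_def kronecker_def vec_of_mat_def scalar_prod_def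
        lessThan_atLeast0 intro!: sum.cong)
  also have "\<dots> = (\<Sum>q<m * m. ((if b = q div m then 1 else 0) * C $$ (a, q mod m)
      - C $$ (b, q div m) * (if a = q mod m then 1 else 0)) * S $$ (q mod m, q div m))"
  proof (intro sum.cong refl)
    fix q assume "q \<in> {..<m * m}"
    then have q: "q < m * m" "q div m < m" "q mod m < m"
      using m by (auto simp: less_mult_imp_div_less)
    have "commutator_mat m C $$ (p, q) = (if b = q div m then 1 else 0) * C $$ (a, q mod m)
        - C $$ (b, q div m) * (if a = q mod m then 1 else 0)"
      using p q ab C by (simp add: commutator_mat_def kronecker_def flip: a_def b_def)
    moreover have "vec_of_mat S $ q = S $$ (q mod m, q div m)"
      using q S by (simp add: vec_of_mat_def)
    ultimately show "commutator_mat m C $$ (p, q) * vec_of_mat S $ q =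
      ((if b = q div m then 1 else 0) * C $$ (a, q mod m)
      - C $$ (b, q div m) * (if a = q mod m then 1 else 0)) * S $$ (q mod m, q div m)" by simp
  qed
  also have "\<dots> = (\<Sum>j<m. \<Sum>i<m. ((if b = j then 1 else 0) * C $$ (a, i)
      - C $$ (b, j) * (if a = i then 1 else 0)) * S $$ (i, j))"
    by (rule split)
  also have "\<dots> = (\<Sum>j<m. \<Sum>i<m. if b = j then C $$ (a, i) * S $$ (i, j) else 0)
      - (\<Sum>j<m. \<Sum>i<m. if a = i then C $$ (b, j) * S $$ (i, j) else 0)"
    by (simp only: sum_subtractf[symmetric])
      (intro sum.cong; auto simp: algebra_simps)
  also have "(\<Sum>j<m. \<Sum>i<m. if b = j then C $$ (a, i) * S $$ (i, j) else 0)
      = (\<Sum>i<m. C $$ (a, i) * S $$ (i, b))"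
    by (subst sum.swap) (use ab in simp)
  also have "(\<Sum>j<m. \<Sum>i<m. if a = i then C $$ (b, j) * S $$ (i, j) else 0)
      = (\<Sum>j<m. S $$ (a, j) * C $$ (j, b))"
    using ab by (intro sum.cong) (auto simp: sym)
  also have "(\<Sum>i<m. C $$ (a, i) * S $$ (i, b)) - (\<Sum>j<m. S $$ (a, j) * C $$ (j, b))
      = (C * S - S * C) $$ (a, b)"
    using ab C S by (simp add: scalar_prod_def lessThan_atLeast0)
  also have "\<dots> = vec_of_mat (C * S - S * C) $ p"
    using p C S by (simp add: vec_of_mat_def a_def b_def)
  finally show "(commutator_mat m C *\<^sub>v vec_of_mat S) $ p = vec_of_mat (C * S - S * C) $ p" .
qed (use C S in \<open>simp add: commutator_mat_def kronecker_def vec_of_mat_def\<close>)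

end

theory Submission
  imports Defs
begin

text \<open>
  By Farkas' lemma, if no \<open>x \<ge> 0\<close> satisfies \<open>A B x = 0\<close> with \<open>x\<^sub>1 + \<dots> + x\<^sub>m\<^sub>-\<^sub>1 > 0\<close>, then there is a
  multiplier \<open>z\<close> such that the transpose of \<open>A B\<close> maps \<open>z\<close> to a vector dominating the indicator of the
  first \<open>m - 1\<close> coordinates. If \<open>x\<close> is the weight vector of a feasible \<open>S\<close>, pairing with \<open>x\<close> gives
  \<open>1 \<le> \<langle>z, A B x\<rangle> = \<langle>z, vec (C S - S C)\<rangle> \<le> \<parallel>z\<parallel>\<^sub>1 \<delta>\<close>, so feasibility forces \<open>\<delta> \<ge> 1 / \<parallel>z\<parallel>\<^sub>1\<close>.
\<close>

section \<open>Farkas' lemma over a linearly ordered field\<close>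

text \<open>
  Induction on the number of inequalities, after Bartl: if the inequality \<open>k\<close> is needed, a point \<open>u\<close>
  violating the conclusion with \<open>a k u = 1\<close> allows projecting along \<open>u\<close> onto the kernel of \<open>a k\<close>.
\<close>
lemma farkas:
  fixes a :: "'i \<Rightarrow> 'j \<Rightarrow> 'a :: linordered_field"
  assumes "finite I"
    and "\<And>x. (\<And>i. i \<in> I \<Longrightarrow> (\<Sum>j\<in>J. a i j * x j) \<le> 0) \<Longrightarrow> (\<Sum>j\<in>J. c j * x j) \<le> 0"
    and "finite J"
  shows "\<exists>l. (\<forall>i\<in>I. 0 \<le> l i) \<and> (\<forall>j\<in>J. c j = (\<Sum>i\<in>I. l i * a i j))"
  using assms
proof (induction I arbitrary: a c rule: finite_induct)
  case empty
  \<comment> \<open>Without constraints every point is admissible; testing at \<open>x = c\<close>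
    makes a sum of squares nonpositive.\<close>
  have "(\<Sum>j\<in>J. c j * c j) \<le> 0"
    by (rule empty.prems) simp
  moreover have "(\<Sum>j\<in>J. c j * c j) \<ge> 0"
    by (intro sum_nonneg) simp
  ultimately have "(\<Sum>j\<in>J. c j * c j) = 0"
    by simp
  then have "\<forall>j\<in>J. c j = 0"
    using \<open>finite J\<close> by (subst (asm) sum_nonneg_eq_0_iff) auto
  then show ?case by simp
next
  case (insert k I)
  let ?ev = "\<lambda>b x. \<Sum>j\<in>J. b j * x j"
  show ?case
  proof (cases "\<forall>x. (\<forall>i\<in>I. ?ev (a i) x \<le> 0) \<longrightarrow> ?ev c x \<le> 0")
    case True
    then obtain l where "\<forall>i\<in>I. 0 \<le> l i" "\<forall>j\<in>J. c j = (\<Sum>i\<in>I. l i * a i j)"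
      using insert.IH[of a c] \<open>finite J\<close> by blast
    moreover have "(\<Sum>i\<in>I. (l(k := 0)) i * a i j) = (\<Sum>i\<in>I. l i * a i j)" for j
      using insert.hyps by (intro sum.cong) auto
    ultimately show ?thesis
      using insert.hyps by (intro exI[of _ "l(k := 0)"]) auto
  next
    case False
    then obtain v where v: "\<And>i. i \<in> I \<Longrightarrow> ?ev (a i) v \<le> 0" "?ev c v > 0"
      by (auto simp: not_le)
    \<comment> \<open>Otherwise \<open>v\<close> would satisfy all inequalities including
      \<open>k\<close>, and then \<open>c\<close> would be nonpositive at \<open>v\<close>.\<close>
    have t: "?ev (a k) v > 0"
      using insert.prems(1)[of v] v by (metis insertE not_le)
    define u where "u j = v j / ?ev (a k) v" for j
    have ev_u: "?ev b u = ?ev b v / ?ev (a k) v" for b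
      by (simp add: u_def sum_divide_distrib)
    have u: "?ev (a i) u \<le> 0" if "i \<in> I" for i
      using v(1)[OF that] t by (simp add: ev_u divide_nonpos_pos)
    have uk: "?ev (a k) u = 1" and uc: "?ev c u > 0"
      using t v(2) by (simp_all add: ev_u)
    \<comment> \<open>\<open>proj b\<close> is the functional \<open>b\<close> composed with the
      projection that sends \<open>x\<close> to \<open>x\<close> minus \<open>a k x\<close> times
      \<open>u\<close>. Hence \<open>proj (a k)\<close> vanishes, and projected points satisfy
      inequality \<open>k\<close> with equality.\<close>
    define proj where "proj b j = b j - ?ev b u * a k j" for b j
    have ev_proj: "?ev (proj b) x = ?ev b (\<lambda>j. x j - ?ev (a k) x * u j)" for b x
    proof -
      have "?ev b (\<lambda>j. x j - t * u j) = ?ev b x - t * ?ev b u" for t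
        by (simp add: right_diff_distrib sum_subtractf sum_distrib_left mult.left_commute)
      moreover have "?ev (proj b) x = ?ev b x - ?ev b u * ?ev (a k) x"
        by (simp add: proj_def left_diff_distrib sum_subtractf sum_distrib_left mult.assoc)
      ultimately show ?thesis by (simp only: mult.commute[of "?ev b u"])
    qed
    have "\<exists>l. (\<forall>i\<in>I. 0 \<le> l i) \<and> (\<forall>j\<in>J. proj c j = (\<Sum>i\<in>I. l i * proj (a i) j))"
    proof (rule insert.IH[OF _ \<open>finite J\<close>])
      fix x assume x: "\<And>i. i \<in> I \<Longrightarrow> ?ev (proj (a i)) x \<le> 0"
      have "?ev (proj (a k)) x = 0"
        unfolding proj_def uk by simp
      then show "?ev (proj c) x \<le> 0"
        unfolding ev_proj using x by (intro insert.prems(1)) (auto simp: ev_proj)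
    qed
    then obtain l where l: "\<And>i. i \<in> I \<Longrightarrow> 0 \<le> l i"
      and lc: "\<And>j. j \<in> J \<Longrightarrow> proj c j = (\<Sum>i\<in>I. l i * proj (a i) j)"
      by blast
    \<comment> \<open>This is the coefficient of \<open>a k\<close> after expanding the projections
      in \<open>lc\<close>. It is positive because \<open>c\<close> is positive at \<open>u\<close>
      while each \<open>a i\<close> with \<open>i\<close> in \<open>I\<close> is nonpositive
      there.\<close>
    define lk where "lk = ?ev c u - (\<Sum>i\<in>I. l i * ?ev (a i) u)"
    have "(\<Sum>i\<in>I. l i * ?ev (a i) u) \<le> 0"
      by (intro sum_nonpos mult_nonneg_nonpos[OF l u])
    then have "lk \<ge> 0"
      using uc by (simp add: lk_def)
    have "c j = lk * a k j + (\<Sum>i\<in>I. l i * a i j)" if "j \<in> J" for j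
    proof -
      have "c j = ?ev c u * a k j + (\<Sum>i\<in>I. l i * (a i j - ?ev (a i) u * a k j))"
        using lc[OF that] by (simp add: proj_def algebra_simps)
      then show ?thesis
        by (simp add: lk_def right_diff_distrib left_diff_distrib sum_subtractf sum_distrib_right
            mult.assoc)
    qed
    moreover have "(\<Sum>i\<in>I. (l(k := lk)) i * a i j) = (\<Sum>i\<in>I. l i * a i j)" for j
      using insert.hyps by (intro sum.cong) auto
    ultimately show ?thesis
      using insert.hyps l \<open>lk \<ge> 0\<close> by (intro exI[of _ "l(k := lk)"]) auto
  qed
qed

text \<open>Each equation becomes two opposite inequalities, and each sign condition a row with
  single entry \<open>- 1\<close>. The difference of the two multipliers of an equation is free in
  sign and serves as \<open>z\<close>; the sign rows contribute a nonpositive term, so the identity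
  for \<open>c\<close> weakens to an inequality.\<close>

lemma farkas_standard_form:
  fixes a :: "'i \<Rightarrow> 'j \<Rightarrow> 'a :: linordered_field"
  assumes "finite I" "finite J"
    and imp: "\<And>x. (\<And>j. j \<in> J \<Longrightarrow> 0 \<le> x j) \<Longrightarrow> (\<And>i. i \<in> I \<Longrightarrow> (\<Sum>j\<in>J. a i j * x j) = 0) \<Longrightarrow>
      (\<Sum>j\<in>J. c j * x j) \<le> 0"
  shows "\<exists>z. \<forall>j\<in>J. c j \<le> (\<Sum>i\<in>I. z i * a i j)"
proof -
  define b where "b p j = (case p of Inl (Inl i) \<Rightarrow> a i j | Inl (Inr i) \<Rightarrow> - a i j
      | Inr i \<Rightarrow> if i = j then - 1 else 0)" for p :: "('i + 'i) + 'j" and j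
  have b: "b (Inl (Inl i)) j = a i j" "b (Inl (Inr i)) j = - a i j"
    "b (Inr j') j = (if j' = j then - 1 else 0)" for i j j'
    by (simp_all add: b_def)
  have "\<exists>l. (\<forall>p\<in>(I <+> I) <+> J. 0 \<le> l p) \<and> (\<forall>j\<in>J. c j = (\<Sum>p\<in>(I <+> I) <+> J. l p * b p j))"
  proof (rule farkas)
    fix x assume x: "\<And>p. p \<in> (I <+> I) <+> J \<Longrightarrow> (\<Sum>j\<in>J. b p j * x j) \<le> 0"
    show "(\<Sum>j\<in>J. c j * x j) \<le> 0"
    proof (rule imp)
      fix j assume "j \<in> J"
      then have "(\<Sum>i\<in>J. b (Inr j) i * x i) \<le> 0"
        by (intro x) auto
      moreover have "(\<Sum>i\<in>J. b (Inr j) i * x i) = (\<Sum>i\<in>J. if j = i then - x i else 0)"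
        by (intro sum.cong) (auto simp: b)
      ultimately show "0 \<le> x j"
        using \<open>j \<in> J\<close> \<open>finite J\<close> by simp
    next
      fix i assume "i \<in> I"
      then have "Inl (Inl i) \<in> (I <+> I) <+> J" "Inl (Inr i) \<in> (I <+> I) <+> J"
        by auto
      from this[THEN x] show "(\<Sum>j\<in>J. a i j * x j) = 0"
        by (simp add: b sum_negf)
    qed
  qed (use assms in auto)
  then obtain l where l: "\<forall>p\<in>(I <+> I) <+> J. 0 \<le> l p"
    and c: "\<forall>j\<in>J. c j = (\<Sum>p\<in>(I <+> I) <+> J. l p * b p j)"
    by (elim exE conjE)
  have "\<forall>j\<in>J. c j \<le> (\<Sum>i\<in>I. (l (Inl (Inl i)) - l (Inl (Inr i))) * a i j)"
  proof
    fix j assume j: "j \<in> J"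
    have "0 \<le> l (Inr j')" if "j' \<in> J" for j'
      using l that by auto
    then have "(\<Sum>j'\<in>J. l (Inr j') * b (Inr j') j) \<le> 0"
      by (intro sum_nonpos) (auto simp: b)
    then show "c j \<le> (\<Sum>i\<in>I. (l (Inl (Inl i)) - l (Inl (Inr i))) * a i j)"
      unfolding bspec[OF c j] using assms(1,2)
      by (simp add: sum.Plus b sum_negf sum_subtractf left_diff_distrib)
  qed
  then show ?thesis by (rule exI[of _ "\<lambda>i. l (Inl (Inl i)) - l (Inl (Inr i))"])
qed

section \<open>Edge numbering and weight vectors\<close>

text \<open>The numbering runs down the columns of the strict lower triangle. Column
  \<open>j\<close> fills a block of \<open>m - j\<close> consecutive positions, and
  \<open>g (j - 1)\<close> in the proof counts the positions before it.\<close>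

lemma edge_index_less:
  assumes "1 \<le> j" "j < j'" "j < i" "i \<le> m" "j' < i'" "i' \<le> m"
  shows "edge_index m i j < edge_index m i' j'"
proof -
  define g where "g = (\<lambda>k. k * (2 * m - Suc k) div 2)"
  have step: "g (Suc k) = g k + (m - Suc k)" if k: "k < m" for k
  proof -
    obtain d where d: "m = Suc (k + d)"
      using less_imp_Suc_add[OF k] by blast
    \<comment> \<open>The numerator grows by the even number \<open>d * 2\<close>, so
      \<open>div 2\<close> grows by exactly \<open>d\<close>, whatever the parity.\<close>
    have "Suc k * (2 * m - Suc (Suc k)) = k * (2 * m - Suc k) + d * 2"
      by (simp add: d algebra_simps)
    then have "g (Suc k) = (k * (2 * m - Suc k) + d * 2) div 2"
      by (simp only: g_def)
    then show ?thesis by (simp add: g_def d)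
  qed
  have mono: "g k \<le> g k'" if "k \<le> k'" "k' \<le> m" for k k'
    using that by (induction rule: dec_induct) (auto simp: step)
  have e: "edge_index m i j = i - j + g (j - 1)" if "1 \<le> j" for i j
    using that by (simp add: edge_index_def g_def)
  have "edge_index m i j \<le> g (j - 1) + (m - Suc (j - 1))"
    using assms by (simp add: e)
  also have "\<dots> = g j"
    using step[of "j - 1"] assms by simp
  also have "\<dots> \<le> g (j' - 1)"
    using assms by (intro mono) auto
  also have "\<dots> < edge_index m i' j'"
    using assms by (simp add: e)
  finally show ?thesis .
qed

text \<open>Different columns occupy disjoint blocks, and inside one column the position determines
  the row. This makes it meaningful to read off a weight at a given position.\<close>

lemma edge_index_inject:
  assumes "1 \<le> j" "j < i" "i \<le> m" "1 \<le> j'" "j' < i'" "i' \<le> m"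
    and eq: "edge_index m i j = edge_index m i' j'"
  shows "i = i' \<and> j = j'"
proof -
  have "j = j'"
    using edge_index_less[of j j' i m i'] edge_index_less[of j' j i' m i] assms
    by (metis less_irrefl linorder_neqE_nat)
  with eq assms show ?thesis by (auto simp: edge_index_def)
qed

text \<open>Inverts the operator \<open>edge_matrix\<close> on valid adjacency matrices: the weight
  at a position is the entry of \<open>S\<close> at the edge numbered by it.\<close>

lemma valid_adjacency_weights:
  assumes S: "S \<in> valid_adjacency m"
  obtains x where "x \<in> carrier_vec (m * (m - 1) div 2)"
    and "\<And>q. q < m * (m - 1) div 2 \<Longrightarrow> 0 \<le> x $ q"
    and "edge_matrix m *\<^sub>v x = vec_of_mat S"
    and "(\<Sum>q<m - 1. x $ q) = (\<Sum>j<m. S $$ (0, j))"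
proof -
  let ?N = "m * (m - 1) div 2"
  have dim: "S \<in> carrier_mat m m" and diag: "\<And>i. i < m \<Longrightarrow> S $$ (i, i) = 0"
    and nonneg: "\<And>i j. i < m \<Longrightarrow> j < m \<Longrightarrow> 0 \<le> S $$ (i, j)"
    using S by (auto simp: valid_adjacency_def)
  have sym: "S $$ (i, j) = S $$ (j, i)" if "i < m" "j < m" for i j
    using that S unfolding valid_adjacency_def
    by (metis (mono_tags, lifting) carrier_matD index_transpose_mat(1) mem_Collect_eq)
  \<comment> \<open>Nodes \<open>i\<close>, \<open>j\<close> and edge positions count from 1, while
    \<open>q\<close> and the entries of \<open>S\<close> count from 0; hence \<open>Suc q\<close>,
    \<open>i - 1\<close> and \<open>j - 1\<close>. The default weight 0 keeps \<open>x\<close>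
    nonnegative at any coordinate without an edge.\<close>
  define edge where "edge q i j \<longleftrightarrow> 1 \<le> j \<and> j < i \<and> i \<le> m \<and> edge_index m i j = Suc q" for q i j
  define weight where "weight q = (if \<exists>i j. edge q i j
      then (case SOME (i, j). edge q i j of (i, j) \<Rightarrow> S $$ (i - 1, j - 1)) else 0)" for q
  have weight: "weight q = S $$ (i - 1, j - 1)" if "edge q i j" for q i j
  proof -
    have "(SOME (i', j'). edge q i' j') = (i, j)"
      using that edge_index_inject unfolding edge_def
      by (intro some_equality) (auto split: prod.splits)
    then show ?thesis using that by (auto simp: weight_def)
  qed
  define x where "x = vec ?N weight"
  have x_edge: "x $ (edge_index m i j - 1) = S $$ (i - 1, j - 1)"
    if "1 \<le> j" "j < i" "i \<le> m" for i j
  proof -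
    have "edge (edge_index m i j - 1) i j"
      using that edge_index_bounds(1)[OF that] by (simp add: edge_def)
    then show ?thesis
      using weight edge_index_bounds[OF that] by (simp add: x_def)
  qed
  show ?thesis
  proof (rule that)
    show x: "x \<in> carrier_vec ?N" by (simp add: x_def)
    show "0 \<le> x $ q" if "q < ?N" for q
    proof (cases "\<exists>i j. edge q i j")
      case True
      then obtain i j where "edge q i j" by blast
      then show ?thesis
        using that nonneg[of "i - 1" "j - 1"] by (auto simp: x_def weight edge_def)
    qed (use that in \<open>simp add: x_def weight_def\<close>)
    show "edge_matrix m *\<^sub>v x = vec_of_mat S"
    proof (rule eq_vecI)
      fix p assume "p < dim_vec (vec_of_mat S)"
      then have p: "p < m * m" using dim by (simp add: vec_of_mat_def)
      then have "m > 0" by (cases m) auto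
      with p have d: "p div m < m" "p mod m < m"
        by (auto simp: less_mult_imp_div_less)
      have "(edge_matrix m *\<^sub>v x) $ p = S $$ (p div m, p mod m)"
        using edge_matrix_mult[OF x, of "p div m + 1" "p mod m + 1"] d
          x_edge[of "p mod m + 1" "p div m + 1"] x_edge[of "p div m + 1" "p mod m + 1"]
        by (auto simp: diag sym Suc_le_eq split: if_splits)
      \<comment> \<open>\<open>edge_matrix\<close> enumerates entries row by row,
        \<open>vec_of_mat\<close> column by column; symmetry of \<open>S\<close> reconciles the
        two.\<close>
      also have "\<dots> = vec_of_mat S $ p"
        using p dim sym[OF d] by (simp add: vec_of_mat_def)
      finally show "(edge_matrix m *\<^sub>v x) $ p = vec_of_mat S $ p" .
    qed (use dim in \<open>simp add: vec_of_mat_def edge_matrix_def\<close>)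
    show "(\<Sum>q<m - 1. x $ q) = (\<Sum>j<m. S $$ (0, j))"
    proof (cases m)
      case (Suc n)
      \<comment> \<open>The edge between nodes \<open>q + 2\<close> and 1 has position
        \<open>q + 1\<close>, that is, coordinate \<open>q\<close>. The row sum has one further
        term, the zero diagonal entry.\<close>
      have "x $ q = S $$ (0, Suc q)" if "q < n" for q
        using x_edge[of 1 "q + 2"] that sym[of 0 "Suc q"] Suc by (simp add: edge_index_def)
      then show ?thesis
        using Suc diag[of 0] by (simp add: sum.lessThan_Suc_shift del: sum.lessThan_Suc)
    qed simp
  qed
qed

section \<open>Norm estimate and infeasibility threshold\<close>

text \<open>The square of one entry is a term of the sum of squares. This sup-norm bound is what
  pairs with the 1-norm of the Farkas multiplier.\<close>

lemma abs_vec_of_mat_le_frobenius_norm: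
  assumes "p < dim_row M * dim_col M"
  shows "\<bar>vec_of_mat M $ p\<bar> \<le> frobenius_norm M"
proof -
  have "dim_row M > 0" using assms by (cases "dim_row M") auto
  then have d: "p mod dim_row M < dim_row M" "p div dim_row M < dim_col M"
    using assms by (auto simp: less_mult_imp_div_less mult.commute)
  have "(M $$ (p mod dim_row M, p div dim_row M))\<^sup>2
      \<le> (\<Sum>j<dim_col M. (M $$ (p mod dim_row M, j))\<^sup>2)"
    using d by (intro member_le_sum) auto
  also have "\<dots> \<le> (\<Sum>i<dim_row M. \<Sum>j<dim_col M. (M $$ (i, j))\<^sup>2)"
    using d by (intro member_le_sum[of _ _ "\<lambda>i. \<Sum>j<dim_col M. (M $$ (i, j))\<^sup>2"] sum_nonneg) auto
  finally show ?thesis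
    using assms unfolding frobenius_norm_def vec_of_mat_def
    by (auto intro!: real_le_rsqrt)
qed

theorem theorem3p2:
  fixes m :: nat and C :: "real mat"
  assumes "2 \<le> m"
    and "C \<in> carrier_mat m m"
    and "transpose_mat C = C"
    and "\<not> (\<exists>y \<in> carrier_vec (m * (m - 1) div 2).
           (commutator_mat m C * edge_matrix m) *\<^sub>v y = 0\<^sub>v (m * m) \<and>
           (\<forall>i < m * (m - 1) div 2. y $ i \<le> 0) \<and>
           (\<Sum>i<m - 1. y $ i) \<noteq> 0)"
  shows "\<exists>\<delta>bar > 0. \<forall>\<delta>. 0 \<le> \<delta> \<and> \<delta> < \<delta>bar \<longrightarrow> rSpecT_infeasible m C \<delta>"
proof -
  let ?N = "m * (m - 1) div 2"
  define A where "A = commutator_mat m C * edge_matrix m"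
  have K: "commutator_mat m C \<in> carrier_mat (m * m) (m * m)"
    using assms(2) by (intro carrier_matI) (simp_all add: commutator_mat_def kronecker_def)
  have B: "edge_matrix m \<in> carrier_mat (m * m) ?N"
    by (simp add: edge_matrix_def)
  have A: "A \<in> carrier_mat (m * m) ?N"
    unfolding A_def using K B by (rule mult_carrier_mat)
  have Av: "(A *\<^sub>v v) $ i = (\<Sum>q<?N. A $$ (i, q) * v $ q)"
    if "i < m * m" "v \<in> carrier_vec ?N" for i v
    using that A by (auto simp: scalar_prod_def lessThan_atLeast0 intro!: sum.cong)
  \<comment> \<open>Since \<open>2 \<le> m\<close>, halving
    \<open>2 * (m - 1) \<le> m * (m - 1)\<close> shows that the first \<open>m - 1\<close>
    coordinates exist.\<close>
  have le: "m - 1 \<le> ?N"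
    using div_le_mono[OF mult_le_mono1[OF assms(1), of "m - 1"], of 2] by simp
  define c :: "nat \<Rightarrow> real" where "c q = (if q < m - 1 then 1 else 0)" for q
  have c_sum: "(\<Sum>q<?N. c q * f q) = (\<Sum>q<m - 1. f q)" for f
    using le by (intro sum.mono_neutral_cong_right) (auto simp: c_def)
  have "\<exists>z. \<forall>q\<in>{..<?N}. c q \<le> (\<Sum>i\<in>{..<m * m}. z i * A $$ (i, q))"
  proof (rule farkas_standard_form)
    fix x :: "nat \<Rightarrow> real"
    assume x: "\<And>q. q \<in> {..<?N} \<Longrightarrow> 0 \<le> x q"
      and eq: "\<And>i. i \<in> {..<m * m} \<Longrightarrow> (\<Sum>q<?N. A $$ (i, q) * x q) = 0"
    \<comment> \<open>The excluded system asks for nonpositive solutions, so the sign is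
      flipped.\<close>
    define y where "y = vec ?N (\<lambda>q. - x q)"
    have "A *\<^sub>v y = 0\<^sub>v (m * m)"
    proof (rule eq_vecI)
      fix i assume i: "i < dim_vec (0\<^sub>v (m * m) :: real vec)"
      then have "(A *\<^sub>v y) $ i = (\<Sum>q<?N. A $$ (i, q) * y $ q)"
        by (intro Av) (simp_all add: y_def)
      also have "\<dots> = - (\<Sum>q<?N. A $$ (i, q) * x q)"
        unfolding sum_negf[symmetric] by (intro sum.cong) (auto simp: y_def)
      finally show "(A *\<^sub>v y) $ i = 0\<^sub>v (m * m) $ i"
        using i eq[of i] by simp
    qed (use A in simp)
    moreover have "y \<in> carrier_vec ?N" "\<forall>i<?N. y $ i \<le> 0"
      using x by (auto simp: y_def)
    ultimately have "(\<Sum>q<m - 1. y $ q) = 0"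
      using assms(4) unfolding A_def by blast
    also have "(\<Sum>q<m - 1. y $ q) = (\<Sum>q<m - 1. - x q)"
      using le by (intro sum.cong) (auto simp: y_def)
    finally show "(\<Sum>q<?N. c q * x q) \<le> 0"
      unfolding c_sum by (simp add: sum_negf)
  qed auto
  then obtain z where z: "\<And>q. q < ?N \<Longrightarrow> c q \<le> (\<Sum>i<m * m. z i * A $$ (i, q))"
    by auto
  define Z where "Z = (\<Sum>i<m * m. \<bar>z i\<bar>)"
  have "Z \<ge> 0" by (simp add: Z_def sum_nonneg)
  have bound: "1 \<le> Z * \<delta>" if S: "S \<in> rSpecT_feasible_set m C \<delta>" for S \<delta>
  proof -
    have valid: "S \<in> valid_adjacency m" and sum1: "(\<Sum>j<m. S $$ (0, j)) = 1"
      and norm: "frobenius_norm (C * S - S * C) \<le> \<delta>"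
      using S by (auto simp: rSpecT_feasible_set_def)
    have dim: "S \<in> carrier_mat m m"
      using valid by (simp add: valid_adjacency_def)
    obtain x where x: "x \<in> carrier_vec ?N" "\<And>q. q < ?N \<Longrightarrow> 0 \<le> x $ q"
      "edge_matrix m *\<^sub>v x = vec_of_mat S" "(\<Sum>q<m - 1. x $ q) = (\<Sum>j<m. S $$ (0, j))"
      using valid_adjacency_weights[OF valid] by blast
    have "A *\<^sub>v x = commutator_mat m C *\<^sub>v (edge_matrix m *\<^sub>v x)"
      unfolding A_def using K B x(1) by (rule assoc_mult_mat_vec)
    also have "\<dots> = vec_of_mat (C * S - S * C)"
      using commutator_mat_mult_vec[OF assms(2,3) dim] x(3) by simp
    finally have Ax: "A *\<^sub>v x = vec_of_mat (C * S - S * C)" .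
    have "1 = (\<Sum>q<?N. c q * x $ q)"
      unfolding c_sum using x(4) sum1 by simp
    also have "\<dots> \<le> (\<Sum>q<?N. (\<Sum>i<m * m. z i * A $$ (i, q)) * x $ q)"
      using z x(2) by (intro sum_mono mult_right_mono) auto
    also have "\<dots> = (\<Sum>i<m * m. z i * (\<Sum>q<?N. A $$ (i, q) * x $ q))"
      unfolding sum_distrib_left sum_distrib_right by (subst sum.swap) (simp add: mult.assoc)
    also have "\<dots> = (\<Sum>i<m * m. z i * vec_of_mat (C * S - S * C) $ i)"
      unfolding Ax[symmetric] using x(1) by (intro sum.cong) (simp_all add: Av)
    also have "\<dots> \<le> (\<Sum>i<m * m. \<bar>z i\<bar> * \<delta>)"
    proof (rule sum_mono)
      fix i assume "i \<in> {..<m * m}"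
      then have "\<bar>vec_of_mat (C * S - S * C) $ i\<bar> \<le> \<delta>"
        using abs_vec_of_mat_le_frobenius_norm[of i "C * S - S * C"] norm assms(2) dim by simp
      then have "\<bar>z i\<bar> * \<bar>vec_of_mat (C * S - S * C) $ i\<bar> \<le> \<bar>z i\<bar> * \<delta>"
        by (intro mult_left_mono) auto
      then show "z i * vec_of_mat (C * S - S * C) $ i \<le> \<bar>z i\<bar> * \<delta>"
        by (metis abs_ge_self abs_mult order_trans)
    qed
    also have "\<dots> = Z * \<delta>" by (simp add: Z_def sum_distrib_right)
    finally show ?thesis .
  qed
  show ?thesis
  proof (intro exI conjI allI impI)
    \<comment> \<open>The denominator \<open>1 + Z\<close> is positive as soon as
      \<open>Z \<ge> 0\<close>, and \<open>Z * \<delta> \<le> (1 + Z) * \<delta> < 1\<close>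
      contradicts \<open>bound\<close>.\<close>
    show "1 / (1 + Z) > 0" using \<open>Z \<ge> 0\<close> by simp
    fix \<delta> assume \<delta>: "0 \<le> \<delta> \<and> \<delta> < 1 / (1 + Z)"
    then have "(1 + Z) * \<delta> < 1"
      using \<open>Z \<ge> 0\<close> by (simp add: field_simps)
    then have "\<not> 1 \<le> Z * \<delta>"
      using \<delta> by (simp add: algebra_simps)
    then show "rSpecT_infeasible m C \<delta>"
      using bound by (auto simp: rSpecT_infeasible_def)
  qed
qed

end
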